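(* Let $\theta\in\Theta$ be a parameter, let $k^*=k^*(\theta)$ be the index of the correct critical region containing $\theta$, and let $\Delta J_{\max}(\theta):=\max_{k\ne k^*}\Delta J_k(\theta)$. Suppose the region index $\tilde k\in\{1,\dots,K\}$ is drawn by softmax sampling with inverse temperature $\beta>0$ from the logits $s_1(\theta),\dots,s_K(\theta)$, and let $\Delta J:=\Delta J_{\tilde k}(\theta)$ be the realized cost gap. Then $$\mathbb{E}[\Delta J\mid\theta]\le \Delta J_{\max}(\theta)\cdot (K-1)\exp\left(-\beta\, m(\theta)\right),$$ where $m(\theta)$ is the score margin $m(\theta)=s_{k^*}(\theta)-\max_{k\ne k^*}s_k(\theta)$.
   Context: **Multi-parametric linear program and critical regions.** For parameters $\theta$ in a bounded polytope $\Theta\subset\mathbb{R}^m$, consider $$x^*(\theta)=\arg\min_{x\in\mathbb{R}^n} c^\top x\quad\text{s.t.}\quad Wx\le S+T\theta .$$ The parameter space $\Theta$ is partitioned into $K$ ($K\ge 2$) convex polyhedral critical regions $\mathrm{CR}_1,\dots,\mathrm{CR}_K$, on each of which the set of active constraints at the optimum is invariant and the optimal solution is affine: $x^*(\theta)=F_k\theta+f_k$ for all $\theta\in\mathrm{CR}_k$. For every $k\in\{1,\dots,K\}$ and every $\theta\in\Theta$ (whether or not $\theta\in\mathrm{CR}_k$), set $x_k(\theta):=F_k\theta+f_k$. For $\theta\in\Theta$, $k^*(\theta)$ denotes the index of the region containing $\theta$, so $x^*(\theta)=x_{k^*}(\theta)=F_{k^*}\theta+f_{k^*}$. **Cost gap.**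 $J(x;\theta)\in\mathbb{R}$ denotes the operational cost when solution $x$ is applied under parameter $\theta$. The cost gap for selecting region $k$ is $\Delta J_k(\theta):=J(x_k(\theta);\theta)-J(x^*(\theta);\theta)$. **Softmax sampling.** $s_1(\theta),\dots,s_K(\theta)\in\mathbb{R}$ are the classifier logits, $s(\theta)=W_{cl}h(\theta)+b_{cl}$ with fixed $W_{cl}\in\mathbb{R}^{K\times n_q}$, $b_{cl}\in\mathbb{R}^K$ and feature vector $h(\theta)\in\mathbb{R}^{n_q}$ (the Pauli-$Z$ expectation values on $n_q$ qubits of the circuit's output state for input $\theta$). The sampled index satisfies $$\mathbb{P}[\tilde k=k\mid\theta]=\frac{\exp(\beta s_k(\theta))}{\sum_{j=1}^K\exp(\beta s_j(\theta))},\quad k=1,\dots,K.$$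
   Formalization: The formal theorem additionally assumes that the maximal cost gap ΔJ_max(θ) is nonnegative; without this the bound fails, e.g. for K = 2 with ΔJ_max(θ) < 0. *)

theory Defs
  imports "HOL-Probability.Probability"
begin

section \<open>Multi-parametric linear programs and critical regions\<close>

definition mplp_feasible ::
    "real^'n^'c \<Rightarrow> real^'c \<Rightarrow> real^'m^'c \<Rightarrow> real^'m \<Rightarrow> (real^'n) set" where
  "mplp_feasible W S T \<theta> = {x. \<forall>i. (W *v x) $ i \<le> (S + T *v \<theta>) $ i}"

definition mplp_optimal ::
    "real^'n \<Rightarrow> real^'n^'c \<Rightarrow> real^'c \<Rightarrow> real^'m^'c \<Rightarrow> real^'m \<Rightarrow> real^'n \<Rightarrow> bool" where
  "mplp_optimal c W S T \<theta> x \<longleftrightarrow> is_arg_min (\<lambda>y. c \<bullet> y) (\<lambda>y. y \<in> mplp_feasible W S T \<theta>) x"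

definition active_set ::
    "real^'n^'c \<Rightarrow> real^'c \<Rightarrow> real^'m^'c \<Rightarrow> real^'m \<Rightarrow> real^'n \<Rightarrow> 'c set" where
  "active_set W S T \<theta> x = {i. (W *v x) $ i = (S + T *v \<theta>) $ i}"

text \<open>
  Like \<^const>\<open>polyhedron\<close>, but the half-spaces may be open or closed. Regions with a constant
  active set that partition a polytope in the strict sense cannot all be closed, since a connected
  set is not the union of finitely many, but at least two, disjoint nonempty closed sets.
\<close>

definition polyhedral :: "'a::euclidean_space set \<Rightarrow> bool" where
  "polyhedral R \<longleftrightarrow> (\<exists>H. finite H \<and> R = \<Inter>H \<and>
     (\<forall>h\<in>H. \<exists>a b. a \<noteq> 0 \<and> (h = {x. a \<bullet> x \<le> b} \<or> h = {x. a \<bullet> x < b})))"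

lemma polyhedron_imp_polyhedral: "polyhedron R \<Longrightarrow> polyhedral R"
  unfolding polyhedron_def polyhedral_def by metis

lemma polyhedral_imp_convex: "polyhedral R \<Longrightarrow> convex R"
  unfolding polyhedral_def
  by (metis convex_Inter convex_halfspace_le convex_halfspace_lt)

definition affine_solution ::
    "('k \<Rightarrow> real^'m^'n) \<Rightarrow> ('k \<Rightarrow> real^'n) \<Rightarrow> 'k \<Rightarrow> real^'m \<Rightarrow> real^'n" where
  "affine_solution F f k \<theta> = F k *v \<theta> + f k"

text \<open>
  The number of regions is the cardinality of the index type \<open>'k\<close>; \<open>xopt\<close> is the solution map
  of the program. If optimisers are not unique, \<open>xopt\<close> may be any selection of them.
\<close>

definition critical_regions ::
    "real^'n \<Rightarrow> real^'n^'c \<Rightarrow> real^'c \<Rightarrow> real^'m^'c \<Rightarrow> (real^'m) set \<Rightarrow> (real^'m \<Rightarrow> real^'n) \<Rightarrow>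
     ('k::finite \<Rightarrow> (real^'m) set) \<Rightarrow> ('k \<Rightarrow> real^'m^'n) \<Rightarrow> ('k \<Rightarrow> real^'n) \<Rightarrow> bool" where
  "critical_regions c W S T \<Theta> xopt CR F f \<longleftrightarrow>
     (\<forall>\<theta>\<in>\<Theta>. mplp_optimal c W S T \<theta> (xopt \<theta>)) \<and>
     inj CR \<and> partition_on \<Theta> (range CR) \<and>
     (\<forall>k. polyhedral (CR k)) \<and>
     (\<forall>k. \<forall>\<theta>\<in>CR k. \<forall>\<theta>'\<in>CR k.
        active_set W S T \<theta> (xopt \<theta>) = active_set W S T \<theta>' (xopt \<theta>')) \<and>
     (\<forall>k. \<forall>\<theta>\<in>CR k. xopt \<theta> = affine_solution F f k \<theta>)"

definition region_index :: "('k \<Rightarrow> 'p set) \<Rightarrow> 'p \<Rightarrow> 'k" where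
  "region_index CR \<theta> = (THE k. \<theta> \<in> CR k)"


section \<open>Cost gap\<close>

definition cost_gap ::
    "(real^'n \<Rightarrow> real^'m \<Rightarrow> real) \<Rightarrow> (real^'m \<Rightarrow> real^'n) \<Rightarrow>
     ('k \<Rightarrow> real^'m^'n) \<Rightarrow> ('k \<Rightarrow> real^'n) \<Rightarrow> 'k \<Rightarrow> real^'m \<Rightarrow> real" where
  "cost_gap J xopt F f k \<theta> = J (affine_solution F f k \<theta>) \<theta> - J (xopt \<theta>) \<theta>"

text \<open>
  The cost \<open>J\<close> is arbitrary, so gaps can be negative. With \<open>J x \<theta> = c \<bullet> x\<close> they may be, because
  \<open>affine_solution F f k \<theta>\<close> need not be feasible outside \<open>CR k\<close>.
\<close>

definition max_cost_gap ::
    "(real^'n \<Rightarrow> real^'m \<Rightarrow> real) \<Rightarrow> (real^'m \<Rightarrow> real^'n) \<Rightarrow> ('k::finite \<Rightarrow> (real^'m) set) \<Rightarrow>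
     ('k \<Rightarrow> real^'m^'n) \<Rightarrow> ('k \<Rightarrow> real^'n) \<Rightarrow> real^'m \<Rightarrow> real" where
  "max_cost_gap J xopt CR F f \<theta> =
     (MAX k \<in> {k. k \<noteq> region_index CR \<theta>}. cost_gap J xopt F f k \<theta>)"


section \<open>Classifier logits and softmax sampling\<close>

text \<open>
  Qubits are indexed by \<open>'q\<close>, and the computational basis by \<open>'q \<Rightarrow> bool\<close>, so that matrices over
  this type act on a space of dimension \<open>2 ^ CARD('q)\<close>. States are density matrices, which
  include the pure states.
\<close>

definition density_matrix :: "complex^'b^'b \<Rightarrow> bool" where
  "density_matrix \<rho> \<longleftrightarrow>
     (\<forall>v::complex^'b. (\<Sum>i\<in>UNIV. cnj (v $ i) * (\<rho> *v v) $ i) \<in> \<real>\<^sub>\<ge>\<^sub>0) \<and> trace \<rho> = 1"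

text \<open>
  The Pauli matrix \<open>Z = diag(1, -1)\<close> on qubit \<open>i\<close>, tensored with the identity on the others.
\<close>

definition pauli_Z :: "'q::finite \<Rightarrow> complex^('q \<Rightarrow> bool)^('q \<Rightarrow> bool)" where
  "pauli_Z i = (\<chi> a b. if a = b then (if a i then -1 else 1) else 0)"

definition Z_expectations :: "complex^('q::finite \<Rightarrow> bool)^('q \<Rightarrow> bool) \<Rightarrow> real^'q" where
  "Z_expectations \<rho> = (\<chi> i. Re (trace (\<rho> ** pauli_Z i)))"

definition logits ::
    "real^'q^'k \<Rightarrow> real^'k \<Rightarrow> ('p \<Rightarrow> complex^('q::finite \<Rightarrow> bool)^('q \<Rightarrow> bool)) \<Rightarrow> 'p \<Rightarrow> real^'k" where
  "logits Wcl bcl \<rho> \<theta> = Wcl *v Z_expectations (\<rho> \<theta>) + bcl"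

definition softmax :: "real \<Rightarrow> real^'k::finite \<Rightarrow> 'k \<Rightarrow> real" where
  "softmax \<beta> s k = exp (\<beta> * s $ k) / (\<Sum>j\<in>UNIV. exp (\<beta> * s $ j))"

definition score_margin :: "real^'k::finite \<Rightarrow> 'k \<Rightarrow> real" where
  "score_margin s k\<^sub>0 = s $ k\<^sub>0 - (MAX k \<in> {k. k \<noteq> k\<^sub>0}. s $ k)"

end

theory Submission
  imports Defs
begin

text \<open>
  The correct region has cost gap zero, because the affine law of the region that contains
  \<open>\<theta>\<close> reproduces the optimiser at \<open>\<theta>\<close>. The expected gap is therefore carried by the
  \<open>K - 1\<close> wrong regions, each of which costs at most the maximal gap. Each wrong region is drawn
  with probability at most \<open>exp (- \<beta> m)\<close>: the softmax normaliser is at least the single term of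
  the correct region, so the probability is at most the ratio of two exponentials, whose logits
  differ by at least the margin \<open>m\<close>. Nonnegativity of the maximal gap is what allows the
  probabilities to be replaced by this upper bound.

  The geometry of the program enters only through \<open>cost_gap_region_index\<close>; the probabilistic part
  is \<open>softmax_mean_le_margin\<close>, which holds for an arbitrary loss that vanishes at a reference index.
\<close>

lemma (in prob_space) expectation_finite_valued:
  fixes X :: "'a \<Rightarrow> 'k::finite" and g :: "'k \<Rightarrow> real"
  assumes X: "X \<in> measurable M (count_space UNIV)"
  shows "expectation (\<lambda>\<omega>. g (X \<omega>)) = (\<Sum>k\<in>UNIV. prob {\<omega> \<in> space M. X \<omega> = k} * g k)"
proof -
  define A where "A k = {\<omega> \<in> space M. X \<omega> = k}" for k
  have A: "A k \<in> events" for k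
    unfolding A_def using X by measurable
  have "expectation (\<lambda>\<omega>. g (X \<omega>)) = expectation (\<lambda>\<omega>. \<Sum>k\<in>UNIV. indicator (A k) \<omega> * g k)"
  proof (rule Bochner_Integration.integral_cong)
    fix \<omega> assume "\<omega> \<in> space M"
    then have "indicator (A k) \<omega> * g k = (if X \<omega> = k then g k else 0)" for k
      by (simp add: A_def indicator_def)
    then show "g (X \<omega>) = (\<Sum>k\<in>UNIV. indicator (A k) \<omega> * g k)"
      by simp
  qed simp
  also have "\<dots> = (\<Sum>k\<in>UNIV. prob (A k) * g k)"
    using A by (subst Bochner_Integration.integral_sum) (auto simp: less_top[symmetric])
  finally show ?thesis
    unfolding A_def .
qed

lemma softmax_nonneg: "0 \<le> softmax \<beta> s k"
  unfolding softmax_def by (intro divide_nonneg_nonneg sum_nonneg) auto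

text \<open>
  Keeping only the term of \<open>j\<close> in the normaliser leaves the ratio of two exponentials.
\<close>

lemma softmax_le_exp_diff: "softmax \<beta> s k \<le> exp (- \<beta> * (s $ j - s $ k))"
proof -
  have "exp (\<beta> * s $ j) \<le> (\<Sum>i\<in>UNIV. exp (\<beta> * s $ i))"
    by (rule member_le_sum) auto
  then have "softmax \<beta> s k \<le> exp (\<beta> * s $ k) / exp (\<beta> * s $ j)"
    unfolding softmax_def by (intro divide_left_mono mult_pos_pos) (auto intro!: sum_pos)
  also have "\<dots> = exp (- \<beta> * (s $ j - s $ k))"
    by (simp add: exp_diff[symmetric] algebra_simps)
  finally show ?thesis .
qed

lemma score_margin_le_diff:
  assumes "k \<noteq> j"
  shows "score_margin s j \<le> s $ j - s $ k"
  unfolding score_margin_def using assms by (auto intro!: Max_ge)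

lemma softmax_le_exp_margin:
  assumes "0 \<le> \<beta>" and "k \<noteq> j"
  shows "softmax \<beta> s k \<le> exp (- \<beta> * score_margin s j)"
proof -
  have "\<beta> * score_margin s j \<le> \<beta> * (s $ j - s $ k)"
    using assms by (intro mult_left_mono score_margin_le_diff)
  then show ?thesis
    by (intro order_trans[OF softmax_le_exp_diff[where j = j]]) simp
qed

lemma softmax_mean_le_margin:
  fixes s :: "real^'k::finite" and g :: "'k \<Rightarrow> real"
  assumes "0 \<le> \<beta>" and "g j = 0" and "0 \<le> D" and g: "\<And>k. k \<noteq> j \<Longrightarrow> g k \<le> D"
  shows "(\<Sum>k\<in>UNIV. softmax \<beta> s k * g k)
    \<le> D * (real CARD('k) - 1) * exp (- \<beta> * score_margin s j)"
proof -
  have "(\<Sum>k\<in>UNIV. softmax \<beta> s k * g k) = (\<Sum>k\<in>UNIV - {j}. softmax \<beta> s k * g k)"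
    using \<open>g j = 0\<close> by (intro sum.mono_neutral_right) auto
  also have "\<dots> \<le> (\<Sum>k\<in>UNIV - {j}. exp (- \<beta> * score_margin s j) * D)"
  proof (rule sum_mono)
    fix k assume "k \<in> UNIV - {j}"
    then have "k \<noteq> j" by simp
    \<comment> \<open>The loss may be negative, so it is replaced by its bound before the probability is.\<close>
    have "softmax \<beta> s k * g k \<le> softmax \<beta> s k * D"
      using \<open>k \<noteq> j\<close> by (intro mult_left_mono g softmax_nonneg)
    also have "\<dots> \<le> exp (- \<beta> * score_margin s j) * D"
      using assms \<open>k \<noteq> j\<close> by (intro mult_right_mono softmax_le_exp_margin)
    finally show "softmax \<beta> s k * g k \<le> exp (- \<beta> * score_margin s j) * D" .
  qed
  also have "\<dots> = real (CARD('k) - 1) * (exp (- \<beta> * score_margin s j) * D)"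
    by (simp add: card_Diff_singleton)
  also have "real (CARD('k) - 1) = real CARD('k) - 1"
    by (simp add: of_nat_diff Suc_leI)
  finally show ?thesis
    by (simp add: mult_ac)
qed

text \<open>
  Disjointness is a property of the set of regions; it determines the index of the region only
  because distinct indices name distinct regions.
\<close>

lemma mem_CR_region_index:
  assumes "inj CR" and "partition_on \<Theta> (range CR)" and "\<theta> \<in> \<Theta>"
  shows "\<theta> \<in> CR (region_index CR \<theta>)"
proof -
  obtain k where k: "\<theta> \<in> CR k"
    using partition_onD1[OF assms(2)] \<open>\<theta> \<in> \<Theta>\<close> by auto
  have "i = k" if "\<theta> \<in> CR i" for i
  proof -
    have "CR i = CR k"
      using disjointD[OF partition_onD2[OF assms(2)], of "CR i" "CR k"] that k by auto
    then show ?thesis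
      using \<open>inj CR\<close> by (simp add: inj_eq)
  qed
  with k show ?thesis
    unfolding region_index_def by (rule theI)
qed

lemma cost_gap_region_index:
  assumes "critical_regions c W S T \<Theta> xopt CR F f" and "\<theta> \<in> \<Theta>"
  shows "cost_gap J xopt F f (region_index CR \<theta>) \<theta> = 0"
proof -
  have "\<theta> \<in> CR (region_index CR \<theta>)"
    using assms unfolding critical_regions_def by (intro mem_CR_region_index[of CR \<Theta>]) auto
  then have "xopt \<theta> = affine_solution F f (region_index CR \<theta>) \<theta>"
    using assms unfolding critical_regions_def by blast
  then show ?thesis
    by (simp add: cost_gap_def)
qed

lemma cost_gap_le_max:
  assumes "k \<noteq> region_index CR \<theta>"
  shows "cost_gap J xopt F f k \<theta> \<le> max_cost_gap J xopt CR F f \<theta>"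
  unfolding max_cost_gap_def using assms by (auto intro!: Max_ge)

theorem theorem2:
  fixes c :: "real^'n" and W :: "real^'n^'c" and S :: "real^'c" and T :: "real^'m^'c"
    and \<Theta> :: "(real^'m) set"
    and xopt :: "real^'m \<Rightarrow> real^'n"
    and CR :: "'k::finite \<Rightarrow> (real^'m) set"
    and F :: "'k \<Rightarrow> real^'m^'n" and f :: "'k \<Rightarrow> real^'n"
    and J :: "real^'n \<Rightarrow> real^'m \<Rightarrow> real"
    and \<rho> :: "real^'m \<Rightarrow> complex^('q::finite \<Rightarrow> bool)^('q \<Rightarrow> bool)"
    and Wcl :: "real^'q^'k" and bcl :: "real^'k"
    and \<beta> :: real and \<theta> :: "real^'m"
    and M :: "'w measure" and ktilde :: "'w \<Rightarrow> 'k"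
  assumes "polytope \<Theta>"
    and "CARD('k) \<ge> 2"
    and "critical_regions c W S T \<Theta> xopt CR F f"
    and "\<And>\<theta>. \<theta> \<in> \<Theta> \<Longrightarrow> density_matrix (\<rho> \<theta>)"
    and "\<theta> \<in> \<Theta>"
    and "max_cost_gap J xopt CR F f \<theta> \<ge> 0"
    and "\<beta> > 0"
    and "prob_space M"
    and "ktilde \<in> measurable M (count_space UNIV)"
    and "\<And>k. measure M {\<omega> \<in> space M. ktilde \<omega> = k} = softmax \<beta> (logits Wcl bcl \<rho> \<theta>) k"
  shows "prob_space.expectation M (\<lambda>\<omega>. cost_gap J xopt F f (ktilde \<omega>) \<theta>)
    \<le> max_cost_gap J xopt CR F f \<theta> * (real CARD('k) - 1) *
        exp (- \<beta> * score_margin (logits Wcl bcl \<rho> \<theta>) (region_index CR \<theta>))"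
proof -
  interpret prob_space M by fact
  have "expectation (\<lambda>\<omega>. cost_gap J xopt F f (ktilde \<omega>) \<theta>)
      = (\<Sum>k\<in>UNIV. softmax \<beta> (logits Wcl bcl \<rho> \<theta>) k * cost_gap J xopt F f k \<theta>)"
    using expectation_finite_valued[OF assms(9), of "\<lambda>k. cost_gap J xopt F f k \<theta>"] assms(10)
    by simp
  also have "\<dots> \<le> max_cost_gap J xopt CR F f \<theta> * (real CARD('k) - 1) *
      exp (- \<beta> * score_margin (logits Wcl bcl \<rho> \<theta>) (region_index CR \<theta>))"
    using assms(7) cost_gap_region_index[OF assms(3,5)] assms(6)
    by (intro softmax_mean_le_margin cost_gap_le_max) auto
  finally show ?thesis .
qed

end
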